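(* Let $k \geq 2$ be an integer and let $\tau = k(k-1)\cdots 21 \in S_k$ be the decreasing permutation of length $k$. For each $n \geq 1$, let $\sigma$ be a permutation chosen uniformly at random from $S_n$ and let $\ell_n^\tau = \ell_n^\tau(\sigma)$ be the length of the longest $\tau$-avoiding subsequence of $\sigma$. Let $p_n^\tau$ be the number of particles (counted over all $k-1$ intervals) in the Hammersley-type particle process described below after $n$ steps. Then $\ell_n^\tau$ and $p_n^\tau$ have the same probability distribution.
   Context: $S_n$ denotes the set of permutations of $[n]=\{1,\dots,n\}$, written in one-line notation $\sigma=\sigma_1\sigma_2\cdots\sigma_n$. For $\tau=\tau_1\cdots\tau_k\in S_k$, a sequence $a_1a_2\cdots a_m$ of distinct numbers contains $\tau$ as a pattern if there are indices $1\le i_1<\dots<i_k\le m$ with $a_{i_s}<a_{i_t}$ if and only if $\tau_s<\tau_t$ for all $1\le s,t\le k$; otherwise it is $\tau$-avoiding. $\ell_n^\tau(\sigma)$ is the maximum length of a subsequence $\sigma_{j_1}\sigma_{j_2}\cdots\sigma_{j_m}$ ($j_1<\dots<j_m$) of $\sigma$ that is $\tau$-avoiding. (For $\tau=21$ this is the length of the longest increasing subsequence.) Particle process: take $k-1$ copies of the unit interval $[0,1]$, labelled $l_1,l_2,\dots,l_{k-1}$. Initially there are no particles. At each step, independently, a point $u$ is chosen uniformly at random in $[0,1]$ and a particle is placed in $l_1$ at position $u_o^1=u$. Simultaneously, the nearest particle in $l_1$ strictly to the right of $u_o^1$ (if any), at position $u_r^1$, is removed from $l_1$ and a particle is placed in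 $l_2$ at position $u_o^2=u_r^1$; then the nearest particle in $l_2$ to the right of $u_o^2$ (if any), at position $u_r^2$, is removed from $l_2$ and a particle is placed in $l_3$ at $u_o^3=u_r^2$; and so on, until the nearest particle in $l_{k-1}$ to the right of $u_o^{k-1}$ (if any) is removed from $l_{k-1}$ and leaves the system. If at some stage there is no particle to the right, the step ends there. $p_n^\tau$ is the total number of particles in $l_1\cup\dots\cup l_{k-1}$ after $n$ steps. *)

theory Defs
  imports "HOL-Probability.Probability" "HOL-Combinatorics.Permutations"
begin

text \<open>Pattern containment: the subsequence of a (indexed by the positions in J, in
increasing order) contains the pattern tau of length k, where tau is given in one-line
notation as a function on {1..k}.\<close>
definition contains_pattern :: "(nat \<Rightarrow> 'b::linorder) \<Rightarrow> nat set \<Rightarrow> (nat \<Rightarrow> nat) \<Rightarrow> nat \<Rightarrow> bool" where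
  "contains_pattern a J tau k \<longleftrightarrow>
     (\<exists>i::nat \<Rightarrow> nat. (\<forall>s\<in>{1..k}. i s \<in> J) \<and>
        (\<forall>s t. 1 \<le> s \<longrightarrow> s < t \<longrightarrow> t \<le> k \<longrightarrow> i s < i t) \<and>
        (\<forall>s\<in>{1..k}. \<forall>t\<in>{1..k}. (a (i s) < a (i t) \<longleftrightarrow> tau s < tau t)))"

definition longest_avoiding :: "nat \<Rightarrow> (nat \<Rightarrow> nat) \<Rightarrow> nat \<Rightarrow> (nat \<Rightarrow> nat) \<Rightarrow> nat" where
  "longest_avoiding n tau k p =
     Max {card J | J. J \<subseteq> {1..n} \<and> \<not> contains_pattern p J tau k}"

definition decreasing_perm :: "nat \<Rightarrow> nat \<Rightarrow> nat" where
  "decreasing_perm k s = k + 1 - s"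

text \<open>Particle process. A state L assigns to each line index j (lines l_1..l_{k-1}) the
finite set of particle positions. cascade m j x L places a particle at x in line j,
where m is the number of lines j, j+1, ..., k-1 remaining (m = 0: the particle leaves).\<close>
fun cascade :: "nat \<Rightarrow> nat \<Rightarrow> real \<Rightarrow> (nat \<Rightarrow> real set) \<Rightarrow> (nat \<Rightarrow> real set)" where
  "cascade 0 j x L = L"
| "cascade (Suc m) j x L =
     (let R = {y \<in> L j. x < y} in
      if R = {} then L(j := insert x (L j))
      else cascade m (Suc j) (Min R) (L(j := insert x (L j - {Min R}))))"

definition particle_step :: "nat \<Rightarrow> real \<Rightarrow> (nat \<Rightarrow> real set) \<Rightarrow> (nat \<Rightarrow> real set)" where
  "particle_step k u L = cascade (k - 1) 1 u L"

definition particle_state :: "nat \<Rightarrow> nat \<Rightarrow> (nat \<Rightarrow> real) \<Rightarrow> (nat \<Rightarrow> real set)" where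
  "particle_state k n u = foldl (\<lambda>L i. particle_step k (u i) L) (\<lambda>_. {}) [0..<n]"

definition particle_count :: "nat \<Rightarrow> nat \<Rightarrow> (nat \<Rightarrow> real) \<Rightarrow> nat" where
  "particle_count k n u = (\<Sum>j=1..k-1. card (particle_state k n u j))"

end

theory Submission
  imports Defs "HOL-Library.Sublist"
begin

text \<open>The particle process is Schensted row insertion, line l_j holding the j-th row of the insertion
  tableau, and the theorem is a form of Greene's theorem. The largest length of a subsequence
  without a decreasing subsequence of length k is invariant under Knuth moves, so a word may be
  replaced by the reading word of its tableau. There the first k - 1 rows attain the value, and
  the columns, being decreasing, bound it from above. Finally, the particle count depends only on the
  relative order of the inserted points, and the relative order of n independent uniform points
  is almost surely a uniformly distributed permutation.\<close>

section \<open>Invariance under Knuth moves\<close>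

text \<open>A Knuth move touches three consecutive letters, while the subsequences to be measured
  are arbitrary. The invariant is therefore the whole set of attainable lengths and not only its
  maximum: a chosen subsequence is repaired at the three letters alone, keeping its length. The
  repair is delicate only when a chosen ascent x, z has to become the descent z, x; the middle
  letter y is then the way out. Speaking of decreasing sequences of length k, rather than of unions
  of k - 1 increasing ones, keeps this argument local. The tableau may have any number of rows,
  whereas the process forgets what leaves its last line. This does no harm, since in an insertion no
  lower row influences a higher one. The process only compares positions, so the values of a
  permutation may themselves serve as positions, although they lie outside the unit
  interval.\<close>

definition avoids_decreasing :: "nat \<Rightarrow> 'a::linorder list \<Rightarrow> bool" where
  "avoids_decreasing k v \<longleftrightarrow> (\<forall>ds. subseq ds v \<longrightarrow> sorted_wrt (>) ds \<longrightarrow> length ds < k)"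

definition avoiding_lengths :: "nat \<Rightarrow> 'a::linorder list \<Rightarrow> nat set" where
  "avoiding_lengths k w = {length v | v. subseq v w \<and> avoids_decreasing k v}"

lemma avoids_decreasingD:
  "avoids_decreasing k v \<Longrightarrow> subseq ds v \<Longrightarrow> sorted_wrt (>) ds \<Longrightarrow> length ds < k"
  by (auto simp: avoids_decreasing_def)

lemma set_subseq_subset: "subseq xs ys \<Longrightarrow> set xs \<subseteq> set ys"
  by (induction rule: list_emb.induct) auto

lemma sorted_wrt_subseq:
  assumes "subseq xs ys" "sorted_wrt P ys"
  shows "sorted_wrt P xs"
  using assms by (induction rule: list_emb.induct) (auto dest!: set_subseq_subset)

lemma subseq_singleton_cases:
  assumes "subseq m [x]"
  shows "m = [] \<or> m = [x]"
  using assms by (auto elim!: list_emb.cases)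

lemma subseq_two_cases:
  assumes "subseq m [x, y]"
  shows "m = [] \<or> m = [x] \<or> m = [y] \<or> m = [x, y]"
  using assms by (auto elim!: list_emb.cases)

lemma subseq_three_cases:
  assumes "subseq m [x, y, z]"
  shows "m = [] \<or> m = [x] \<or> m = [y] \<or> m = [z] \<or> m = [x, y] \<or> m = [x, z] \<or> m = [y, z] \<or> m = [x, y, z]"
  using assms by (auto elim!: list_emb.cases)

text \<open>A decreasing sequence that is new after the swap must use both swapped letters, for one
  using at most one of them was there before. The parts \<open>p\<close> and \<open>q\<close> are
  what it uses on either side.\<close>

lemma not_avoids_swap:
  fixes x z :: "'a::linorder"
  assumes "avoids_decreasing k (a @ x # z # b)" "\<not> avoids_decreasing k (a @ z # x # b)"
  obtains p q where "subseq p a" "subseq q b" "sorted_wrt (>) (p @ z # x # q)"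
    "k \<le> length p + length q + 2"
proof -
  obtain ds where ds: "subseq ds (a @ z # x # b)" "sorted_wrt (>) ds" "k \<le> length ds"
    using assms(2) by (auto simp: avoids_decreasing_def not_less)
  then obtain p m q where ds_eq: "ds = p @ m @ q" and p: "subseq p a" and m: "subseq m [z, x]"
    and q: "subseq q b"
    by (metis append_Cons append_Nil subseq_appendE)
  have "m = [z, x]"
  proof (rule ccontr)
    assume "m \<noteq> [z, x]"
    then have "subseq m [x, z]"
      using subseq_two_cases[OF m] by auto
    then have "subseq ds (a @ [x, z] @ b)"
      unfolding ds_eq using p q by (intro list_emb_append_mono) auto
    then show False
      using avoids_decreasingD[OF assms(1)] ds by fastforce
  qed
  then show thesis
    using that[OF p q] ds ds_eq by auto
qed

text \<open>The exchange argument behind both Knuth moves: a long decreasing sequence through y and one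
  through z, x can be recombined into one through z and one through x, and these have the same
  total length minus one; so one of them is too long already in the unswapped sequence.\<close>

lemma avoids_replace:
  fixes x y z :: "'a::linorder"
  assumes av: "avoids_decreasing k (a @ x # z # b)" and nav: "\<not> avoids_decreasing k (a @ z # x # b)"
    and order: "x \<le> y" "y \<le> z"
    and m: "m = [y, z] \<or> m = [x, y]"
  shows "avoids_decreasing k (a @ m @ b)"
proof (rule ccontr)
  obtain p q where pq: "subseq p a" "subseq q b" "sorted_wrt (>) (p @ z # x # q)"
    "k \<le> length p + length q + 2"
    using not_avoids_swap[OF av nav] .
  assume "\<not> avoids_decreasing k (a @ m @ b)"
  then obtain ds where ds: "subseq ds (a @ m @ b)" "sorted_wrt (>) ds" "k \<le> length ds"
    by (auto simp: avoids_decreasing_def not_less)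
  then obtain p' n q' where ds_eq: "ds = p' @ n @ q'" and p': "subseq p' a" and n: "subseq n m"
    and q': "subseq q' b"
    by (metis subseq_appendE)
  \<comment> \<open>Every other choice is either not strictly decreasing, because x \<le> y \<le> z,
    or uses at most one of x and z and so already fits into the unswapped sequence.\<close>
  have "n = [y]"
  proof (rule ccontr)
    assume "n \<noteq> [y]"
    moreover have "sorted_wrt (>) n"
      using ds ds_eq by (simp add: sorted_wrt_append)
    moreover have "n = [] \<or> n = [hd m] \<or> n = [last m] \<or> n = m"
      using m n subseq_two_cases by fastforce
    ultimately have "subseq n [x, z]"
      using m order by auto
    then have "subseq ds (a @ [x, z] @ b)"
      unfolding ds_eq using p' q' by (intro list_emb_append_mono) auto
    then show False
      using avoids_decreasingD[OF av] ds by fastforce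
  qed
  with ds ds_eq have p'q': "sorted_wrt (>) (p' @ y # q')" "k \<le> length p' + length q' + 1"
    by auto
  have "subseq (p @ [z] @ q') (a @ [x, z] @ b)"
    using pq q' by (intro list_emb_append_mono) auto
  moreover have "sorted_wrt (>) (p @ [z] @ q')"
    using pq(3) p'q'(1) order by (fastforce simp: sorted_wrt_append)
  ultimately have "length p + length q' + 1 < k"
    using avoids_decreasingD[OF av] by fastforce
  moreover have "subseq (p' @ [x] @ q) (a @ [x, z] @ b)"
    using pq p' by (intro list_emb_append_mono) auto
  moreover have "sorted_wrt (>) (p' @ [x] @ q)"
    using pq(3) p'q'(1) order by (fastforce simp: sorted_wrt_append)
  ultimately have "length p' + length q + 1 < k"
    using avoids_decreasingD[OF av] by fastforce
  then show False
    using \<open>length p + length q' + 1 < k\<close> pq(4) p'q'(2) by linarith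
qed

text \<open>A decreasing sequence in the new word contains at most one of the ascending letters x,
  z, so their order is irrelevant to it. This settles the easy direction of both Knuth
  moves.\<close>

lemma avoids_decreasing_unswap:
  fixes x z :: "'a::linorder"
  assumes "x \<le> z" "avoids_decreasing k (a @ z # x # b)"
  shows "avoids_decreasing k (a @ x # z # b)"
  unfolding avoids_decreasing_def
proof (intro allI impI)
  fix ds
  assume ds: "subseq ds (a @ x # z # b)" "sorted_wrt (>) ds"
  then obtain p m q where ds_eq: "ds = p @ m @ q" and p: "subseq p a" and m: "subseq m [x, z]"
    and q: "subseq q b"
    by (metis append_Cons append_Nil subseq_appendE)
  have "sorted_wrt (>) m"
    using ds ds_eq by (simp add: sorted_wrt_append)
  then have "subseq m [z, x]"
    using subseq_two_cases[OF m] assms(1) by auto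
  then have "subseq ds (a @ [z, x] @ b)"
    unfolding ds_eq using p q by (intro list_emb_append_mono) auto
  then show "length ds < k"
    using avoids_decreasingD[OF assms(2)] ds by fastforce
qed

lemma avoiding_lengths_Knuth1:
  fixes x y z :: "'a::linorder"
  assumes "x < y" "y \<le> z"
  shows "avoiding_lengths k (A @ y # z # x # B) = avoiding_lengths k (A @ y # x # z # B)"
proof (rule set_eqI, rule iffI)
  fix l
  assume "l \<in> avoiding_lengths k (A @ y # z # x # B)"
  then obtain v where v: "subseq v (A @ [y, z, x] @ B)" "avoids_decreasing k v" "l = length v"
    by (auto simp: avoiding_lengths_def)
  then obtain a m b where v_eq: "v = a @ m @ b" and a: "subseq a A" and m: "subseq m [y, z, x]"
    and b: "subseq b B"
    by (metis subseq_appendE)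
  have "\<exists>m'. subseq m' [y, x, z] \<and> length m' = length m \<and> avoids_decreasing k (a @ m' @ b)"
  proof (cases "m = [z, x] \<or> m = [y, z, x]")
    case True
    then have "avoids_decreasing k (a @ (butlast (butlast m) @ [x, z]) @ b)"
      using v(2) avoids_decreasing_unswap[of x z k a b] avoids_decreasing_unswap[of x z k "a @ [y]" b]
        assms unfolding v_eq by auto
    then show ?thesis
      using True by (intro exI[of _ "butlast (butlast m) @ [x, z]"]) auto
  next
    case False
    then show ?thesis
      using subseq_three_cases[OF m] v(2) unfolding v_eq by (intro exI[of _ m]) auto
  qed
  then obtain m' where "subseq m' [y, x, z]" "length m' = length m" "avoids_decreasing k (a @ m' @ b)"
    by blast
  moreover from this have "subseq (a @ m' @ b) (A @ [y, x, z] @ B)"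
    using a b by (intro list_emb_append_mono) auto
  ultimately show "l \<in> avoiding_lengths k (A @ y # x # z # B)"
    unfolding avoiding_lengths_def using v(3) v_eq by (intro CollectI exI[of _ "a @ m' @ b"]) auto
next
  fix l
  assume "l \<in> avoiding_lengths k (A @ y # x # z # B)"
  then obtain v where v: "subseq v (A @ [y, x, z] @ B)" "avoids_decreasing k v" "l = length v"
    by (auto simp: avoiding_lengths_def)
  then obtain a m b where v_eq: "v = a @ m @ b" and a: "subseq a A" and m: "subseq m [y, x, z]"
    and b: "subseq b B"
    by (metis subseq_appendE)
  have "\<exists>m'. subseq m' [y, z, x] \<and> length m' = length m \<and> avoids_decreasing k (a @ m' @ b)"
  proof -
    consider "m = [x, z]" | "m = [y, x, z]" | "m \<noteq> [x, z]" "m \<noteq> [y, x, z]" by blast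
    then show ?thesis
    proof cases
      case 1
      show ?thesis
      \<comment> \<open>Since y is not in use, it is free to stand in for x should z, x create a
        long decreasing sequence.\<close>
      proof (cases "avoids_decreasing k (a @ [z, x] @ b)")
        case True
        then show ?thesis using 1 by (intro exI[of _ "[z, x]"]) auto
      next
        case False
        then have "avoids_decreasing k (a @ [y, z] @ b)"
          using avoids_replace[of k a x z b y "[y, z]"] v(2) 1 assms unfolding v_eq by auto
        then show ?thesis using 1 by (intro exI[of _ "[y, z]"]) auto
      qed
    next
      case 2
      \<comment> \<open>A long decreasing sequence through z, x cannot contain the y just before z,
        as y \<le> z. Putting y in place of z yields a sequence of the same length that is already
        present in \<open>v\<close>.\<close>
      have "avoids_decreasing k ((a @ [y]) @ z # x # b)"
      proof (rule ccontr)
        assume nav: "\<not> ?thesis"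
        have av: "avoids_decreasing k ((a @ [y]) @ x # z # b)"
          using v(2) 2 unfolding v_eq by simp
        obtain p q where pq: "subseq p (a @ [y])" "subseq q b" "sorted_wrt (>) (p @ z # x # q)"
          "k \<le> length p + length q + 2"
          using not_avoids_swap[OF av nav] .
        obtain p1 p2 where p: "p = p1 @ p2" "subseq p1 a" "subseq p2 [y]"
          using pq(1) by (rule subseq_appendE)
        have "p2 = []"
          using p pq(3) assms subseq_singleton_cases[OF p(3)] by (auto simp: sorted_wrt_append)
        then have "subseq (p @ [y, x] @ q) (a @ [y, x, z] @ b)"
          using p pq by (intro list_emb_append_mono) auto
        moreover have "sorted_wrt (>) (p @ [y, x] @ q)"
          using pq(3) assms by (fastforce simp: sorted_wrt_append)
        ultimately show False
          using avoids_decreasingD[OF av, of "p @ [y, x] @ q"] pq(4) by simp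
      qed
      then show ?thesis using 2 by (intro exI[of _ "[y, z, x]"]) auto
    next
      case 3
      then show ?thesis
        using subseq_three_cases[OF m] v(2) unfolding v_eq by (intro exI[of _ m]) auto
    qed
  qed
  then obtain m' where "subseq m' [y, z, x]" "length m' = length m" "avoids_decreasing k (a @ m' @ b)"
    by blast
  moreover from this have "subseq (a @ m' @ b) (A @ [y, z, x] @ B)"
    using a b by (intro list_emb_append_mono) auto
  ultimately show "l \<in> avoiding_lengths k (A @ y # z # x # B)"
    unfolding avoiding_lengths_def using v(3) v_eq by (intro CollectI exI[of _ "a @ m' @ b"]) auto
qed

text \<open>The mirror image of \<open>avoiding_lengths_Knuth1\<close>: the witness y now stands to
  the right of the exchanged pair, so it replaces z where it replaced x before, and x where it
  replaced z.\<close>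

lemma avoiding_lengths_Knuth2:
  fixes x y z :: "'a::linorder"
  assumes "x \<le> y" "y < z"
  shows "avoiding_lengths k (A @ z # x # y # B) = avoiding_lengths k (A @ x # z # y # B)"
proof (rule set_eqI, rule iffI)
  fix l
  assume "l \<in> avoiding_lengths k (A @ z # x # y # B)"
  then obtain v where v: "subseq v (A @ [z, x, y] @ B)" "avoids_decreasing k v" "l = length v"
    by (auto simp: avoiding_lengths_def)
  then obtain a m b where v_eq: "v = a @ m @ b" and a: "subseq a A" and m: "subseq m [z, x, y]"
    and b: "subseq b B"
    by (metis subseq_appendE)
  have "\<exists>m'. subseq m' [x, z, y] \<and> length m' = length m \<and> avoids_decreasing k (a @ m' @ b)"
  proof (cases "m = [z, x] \<or> m = [z, x, y]")
    case True
    then have "avoids_decreasing k (a @ ([x, z] @ tl (tl m)) @ b)"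
      using v(2) avoids_decreasing_unswap[of x z k a b] avoids_decreasing_unswap[of x z k a "y # b"]
        assms unfolding v_eq by auto
    then show ?thesis
      using True by (intro exI[of _ "[x, z] @ tl (tl m)"]) auto
  next
    case False
    then show ?thesis
      using subseq_three_cases[OF m] v(2) unfolding v_eq by (intro exI[of _ m]) auto
  qed
  then obtain m' where "subseq m' [x, z, y]" "length m' = length m" "avoids_decreasing k (a @ m' @ b)"
    by blast
  moreover from this have "subseq (a @ m' @ b) (A @ [x, z, y] @ B)"
    using a b by (intro list_emb_append_mono) auto
  ultimately show "l \<in> avoiding_lengths k (A @ x # z # y # B)"
    unfolding avoiding_lengths_def using v(3) v_eq by (intro CollectI exI[of _ "a @ m' @ b"]) auto
next
  fix l
  assume "l \<in> avoiding_lengths k (A @ x # z # y # B)"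
  then obtain v where v: "subseq v (A @ [x, z, y] @ B)" "avoids_decreasing k v" "l = length v"
    by (auto simp: avoiding_lengths_def)
  then obtain a m b where v_eq: "v = a @ m @ b" and a: "subseq a A" and m: "subseq m [x, z, y]"
    and b: "subseq b B"
    by (metis subseq_appendE)
  have "\<exists>m'. subseq m' [z, x, y] \<and> length m' = length m \<and> avoids_decreasing k (a @ m' @ b)"
  proof -
    consider "m = [x, z]" | "m = [x, z, y]" | "m \<noteq> [x, z]" "m \<noteq> [x, z, y]" by blast
    then show ?thesis
    proof cases
      case 1
      show ?thesis
      proof (cases "avoids_decreasing k (a @ [z, x] @ b)")
        case True
        then show ?thesis using 1 by (intro exI[of _ "[z, x]"]) auto
      next
        case False
        then have "avoids_decreasing k (a @ [x, y] @ b)"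
          using avoids_replace[of k a x z b y "[x, y]"] v(2) 1 assms unfolding v_eq by auto
        then show ?thesis using 1 by (intro exI[of _ "[x, y]"]) auto
      qed
    next
      case 2
      \<comment> \<open>A decreasing sequence through z, x cannot go on with y, as x \<le> y;
        replacing x by y gives one of the same length that is already present in
        \<open>v\<close>.\<close>
      have "avoids_decreasing k (a @ z # x # y # b)"
      proof (rule ccontr)
        assume nav: "\<not> ?thesis"
        have av: "avoids_decreasing k (a @ x # z # y # b)"
          using v(2) 2 unfolding v_eq by simp
        obtain p q where pq: "subseq p a" "subseq q (y # b)" "sorted_wrt (>) (p @ z # x # q)"
          "k \<le> length p + length q + 2"
          using not_avoids_swap[OF av nav] .
        have "subseq q b"
        proof (cases q)
          case (Cons c q')
          then have "c \<noteq> y" using pq(3) assms by (auto simp: sorted_wrt_append)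
          then show ?thesis using pq(2) Cons by (metis subseq_Cons2_neq)
        qed simp
        then have "subseq (p @ [z, y] @ q) (a @ [x, z, y] @ b)"
          using pq by (intro list_emb_append_mono) auto
        moreover have "sorted_wrt (>) (p @ [z, y] @ q)"
          using pq(3) assms by (fastforce simp: sorted_wrt_append)
        ultimately show False
          using avoids_decreasingD[OF av, of "p @ [z, y] @ q"] pq(4) by simp
      qed
      then show ?thesis using 2 by (intro exI[of _ "[z, x, y]"]) auto
    next
      case 3
      then show ?thesis
        using subseq_three_cases[OF m] v(2) unfolding v_eq by (intro exI[of _ m]) auto
    qed
  qed
  then obtain m' where "subseq m' [z, x, y]" "length m' = length m" "avoids_decreasing k (a @ m' @ b)"
    by blast
  moreover from this have "subseq (a @ m' @ b) (A @ [z, x, y] @ B)"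
    using a b by (intro list_emb_append_mono) auto
  ultimately show "l \<in> avoiding_lengths k (A @ z # x # y # B)"
    unfolding avoiding_lengths_def using v(3) v_eq by (intro CollectI exI[of _ "a @ m' @ b"]) auto
qed

text \<open>First half of a row insertion in terms of words: x travels left through the end of the
  row until it stands right behind the entry y that it bumps. Each exchange is a
  \<open>avoiding_lengths_Knuth1\<close> move whose witness is the left neighbour of the exchanged
  pair.\<close>

lemma avoiding_lengths_move_left:
  fixes x y :: "'a::linorder"
  assumes "sorted (y # r)" "x < y"
  shows "avoiding_lengths k (A @ y # r @ x # B) = avoiding_lengths k (A @ y # x # r @ B)"
  using assms
proof (induction r arbitrary: A y)
  case (Cons b r)
  then have "avoiding_lengths k ((A @ [y]) @ b # r @ x # B) = avoiding_lengths k ((A @ [y]) @ b # x # r @ B)"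
    by (intro Cons.IH) auto
  also have "\<dots> = avoiding_lengths k (A @ y # x # b # r @ B)"
    using Cons.prems avoiding_lengths_Knuth1[of x y b k A "r @ B"] by simp
  finally show ?case by simp
qed simp

text \<open>Second half of a row insertion: the bumped y leaves the row to the left, past the
  entries that are at most x. Each exchange is a \<open>avoiding_lengths_Knuth2\<close> move whose
  witness is the right neighbour of the exchanged pair.\<close>

lemma avoiding_lengths_move_out:
  fixes x y :: "'a::linorder"
  assumes "sorted (r @ [x])" "x < y"
  shows "avoiding_lengths k (A @ r @ y # x # B) = avoiding_lengths k (A @ y # r @ x # B)"
  using assms
proof (induction r arbitrary: A)
  case (Cons a r)
  then have "avoiding_lengths k ((A @ [a]) @ r @ y # x # B) = avoiding_lengths k ((A @ [a]) @ y # r @ x # B)"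
    by (intro Cons.IH) auto
  \<comment> \<open>The witness \<open>c\<close> is the next entry of the row, or x itself once the
    entries are exhausted.\<close>
  also obtain c r' where c: "r @ [x] = c # r'"
    by (cases r) auto
  have "(A @ [a]) @ y # r @ x # B = A @ a # y # (r @ [x]) @ B" by simp
  also have "\<dots> = A @ a # y # c # r' @ B" using c by simp
  also have "avoiding_lengths k \<dots> = avoiding_lengths k (A @ y # a # c # r' @ B)"
  proof (rule avoiding_lengths_Knuth2[symmetric])
    have "c \<in> set (r @ [x])" using c by simp
    then show "a \<le> c" "c < y"
      using Cons.prems by (auto simp: sorted_append)
  qed
  also have "A @ y # a # c # r' @ B = A @ y # a # (r @ [x]) @ B" using c by simp
  finally show ?case by simp
qed simp

section \<open>Schensted insertion and Greene's theorem\<close>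

text \<open>The row is split at its first entry strictly greater than x, which corresponds to the
  nearest particle strictly to the right.\<close>

fun schensted_insert :: "'a::linorder \<Rightarrow> 'a list list \<Rightarrow> 'a list list" where
  "schensted_insert x [] = [[x]]"
| "schensted_insert x (r # rs) =
     (case dropWhile (\<lambda>a. a \<le> x) r of
        [] \<Rightarrow> (r @ [x]) # rs
      | y # r2 \<Rightarrow> (takeWhile (\<lambda>a. a \<le> x) r @ x # r2) # schensted_insert y rs)"

lemma schensted_insert_Cons_cases:
  fixes x :: "'a::linorder"
  obtains (append) "\<forall>a\<in>set r. a \<le> x" "schensted_insert x (r # rs) = (r @ [x]) # rs"
  | (bump) r1 y r2 where "r = r1 @ y # r2" "\<forall>a\<in>set r1. a \<le> x" "x < y"
      "schensted_insert x (r # rs) = (r1 @ x # r2) # schensted_insert y rs"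
proof (cases "dropWhile (\<lambda>a. a \<le> x) r")
  case Nil
  then have "schensted_insert x (r # rs) = (r @ [x]) # rs" by (simp only: schensted_insert.simps list.case)
  then show thesis using append Nil by simp
next
  case (Cons y r2)
  show thesis
  proof (rule bump)
    show "r = takeWhile (\<lambda>a. a \<le> x) r @ y # r2"
      by (metis Cons takeWhile_dropWhile_id)
    show "x < y"
      using Cons by (metis dropWhile_eq_Cons_conv linorder_not_less)
  qed (use Cons in \<open>auto dest: set_takeWhileD\<close>)
qed

abbreviation reading_word :: "'a list list \<Rightarrow> 'a list" where
  "reading_word T \<equiv> concat (rev T)"

text \<open>The reading word lists the last row first, so a letter pushed out of a row on the left
  arrives at the right end of the rows below and is ready to be inserted there. The suffix
  \<open>B\<close> has to be arbitrary because it absorbs the finished upper rows.\<close>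

lemma avoiding_lengths_schensted_insert:
  fixes x :: "'a::linorder"
  assumes "\<forall>r\<in>set T. sorted r"
  shows "avoiding_lengths k (reading_word T @ x # B) = avoiding_lengths k (reading_word (schensted_insert x T) @ B)"
  using assms
proof (induction T arbitrary: x B)
  case (Cons r T)
  show ?case
  proof (cases r x T rule: schensted_insert_Cons_cases)
    case append
    then show ?thesis by simp
  next
    case (bump r1 y r2)
    have sorted: "sorted (r1 @ y # r2)" using Cons.prems bump by simp
    have "avoiding_lengths k (reading_word (r # T) @ x # B)
        = avoiding_lengths k ((reading_word T @ r1) @ y # r2 @ x # B)"
      using bump by simp
    also have "\<dots> = avoiding_lengths k ((reading_word T @ r1) @ y # x # r2 @ B)"
      using sorted bump by (intro avoiding_lengths_move_left) (auto simp: sorted_append)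
    also have "\<dots> = avoiding_lengths k (reading_word T @ y # r1 @ x # r2 @ B)"
      using avoiding_lengths_move_out[of r1 x y k "reading_word T" "r2 @ B"] sorted bump
      by (auto simp: sorted_append)
    also have "\<dots> = avoiding_lengths k (reading_word (schensted_insert y T) @ r1 @ x # r2 @ B)"
      using Cons by simp
    finally show ?thesis using bump by simp
  qed
qed simp

text \<open>Here \<open>r\<close> is the upper and \<open>s\<close> the lower row: columns increase
  strictly downwards and the shape is that of a partition. Together with weakly increasing rows this
  makes \<open>tableau\<close> the notion of a semistandard tableau.\<close>

definition dominates :: "'a::linorder list \<Rightarrow> 'a list \<Rightarrow> bool" where
  "dominates r s \<longleftrightarrow> length s \<le> length r \<and> (\<forall>i<length s. r ! i < s ! i)"

definition tableau :: "'a::linorder list list \<Rightarrow> bool" where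
  "tableau T \<longleftrightarrow> (\<forall>r\<in>set T. sorted r) \<and> successively dominates T"

lemma tableau_Cons:
  "tableau (r # T) \<longleftrightarrow> sorted r \<and> (T = [] \<or> dominates r (hd T)) \<and> tableau T"
  by (cases T) (auto simp: tableau_def)

lemma transp_dominates: "transp dominates"
  unfolding transp_def dominates_def by (meson order.strict_trans order.strict_trans2 order_trans)

text \<open>The only threat is to the new columns. The entry below the bumped y exceeds y, so y
  lands in the next row in its old column or further left, where the entries above it are now
  smaller than y.\<close>

lemma tableau_schensted_insert:
  fixes x :: "'a::linorder"
  assumes "tableau T"
  shows "tableau (schensted_insert x T)"
  using assms
proof (induction T arbitrary: x)
  case Nil
  then show ?case by (simp add: tableau_def)
next
  case (Cons r T)
  show ?case
  proof (cases r x T rule: schensted_insert_Cons_cases)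
    case append
    then show ?thesis
      using Cons.prems by (auto simp: tableau_Cons sorted_append dominates_def nth_append)
  next
    case (bump r1 y r2)
    have r: "sorted (r1 @ y # r2)" and T: "T = [] \<or> dominates (r1 @ y # r2) (hd T)" "tableau T"
      using Cons.prems bump by (auto simp: tableau_Cons)
    have new_sorted: "sorted (r1 @ x # r2)"
      using r bump by (fastforce simp: sorted_append)
    have le: "(r1 @ x # r2) ! i \<le> (r1 @ y # r2) ! i" for i
      using bump by (auto simp: nth_append nth_Cons split: nat.splits)
    have less_y: "(r1 @ x # r2) ! i < y" if "i \<le> length r1" for i
      proof (cases "i = length r1")
      case False
      then have "(r1 @ x # r2) ! i \<in> set r1" using that by (simp add: nth_append)
      then show ?thesis using bump by fastforce
    qed (use bump in simp)
    have "dominates (r1 @ x # r2) (hd (schensted_insert y T))"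
    proof (cases T)
      case Nil
      then show ?thesis using less_y[of 0] by (simp add: dominates_def)
    next
      case (Cons s S)
      then have dom: "dominates (r1 @ y # r2) s" using T by simp
      show ?thesis
      proof (cases s y S rule: schensted_insert_Cons_cases)
        case append
        \<comment> \<open>The number \<open>length r1\<close> is the column that y left. Were there
          an entry of \<open>s\<close> in that column, it would exceed y, and y could not be
          appended.\<close>
        have "length s \<le> length r1"
        proof (rule ccontr)
          assume "\<not> ?thesis"
          then have "y < s ! length r1" and "s ! length r1 \<in> set s"
            using dom by (auto simp: dominates_def not_le dest!: spec[of _ "length r1"])
          then show False using append by force
        qed
        then show ?thesis
          using append dom Cons less_y order.strict_trans1[OF le]
          by (auto simp: dominates_def nth_append less_Suc_eq)
      next
        case (bump s1 z s2)
        have "length s1 \<le> length r1"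
        proof (rule ccontr)
          assume "\<not> ?thesis"
          then have "y < s ! length r1" and "s ! length r1 \<in> set s1"
            using dom bump by (auto simp: dominates_def nth_append not_le dest!: spec[of _ "length r1"])
          then show False using bump by force
        qed
        then have "(r1 @ x # r2) ! i < (s1 @ y # s2) ! i" if "i < length s" for i
        proof (cases "i = length s1")
          case True
          then show ?thesis using less_y[of i] \<open>length s1 \<le> length r1\<close> by simp
        next
          case False
          then have "(s1 @ y # s2) ! i = s ! i"
            using bump by (auto simp: nth_append nth_Cons split: nat.splits)
          then show ?thesis
            using that dom order.strict_trans1[OF le] by (auto simp: dominates_def)
        qed
        then show ?thesis
          using bump dom Cons by (auto simp: dominates_def)
      qed
    qed
    then show ?thesis
      using bump new_sorted Cons.IH[OF T(2)] by (simp add: tableau_Cons)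
  qed
qed

definition schensted :: "'a::linorder list \<Rightarrow> 'a list list" where
  "schensted w = foldl (\<lambda>T x. schensted_insert x T) [] w"

lemma schensted_snoc: "schensted (w @ [x]) = schensted_insert x (schensted w)"
  by (simp add: schensted_def)

lemma tableau_schensted: "tableau (schensted w)"
proof (induction w rule: rev_induct)
  case Nil
  then show ?case by (simp add: schensted_def tableau_def)
qed (simp add: schensted_snoc tableau_schensted_insert)

text \<open>The suffix \<open>B\<close> stands for the part of the word still to be
  inserted.\<close>

lemma avoiding_lengths_schensted:
  "avoiding_lengths k (reading_word (schensted w) @ B) = avoiding_lengths k (w @ B)"
proof (induction w arbitrary: B rule: rev_induct)
  case Nil
  then show ?case by (simp add: schensted_def)
next
  case (snoc x w)
  have "\<forall>r\<in>set (schensted w). sorted r"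
    using tableau_schensted[of w] by (simp add: tableau_def)
  then show ?case
    using snoc avoiding_lengths_schensted_insert[of "schensted w" k x B] by (simp add: schensted_snoc)
qed

lemma mset_schensted_insert:
  "mset (concat (schensted_insert x T)) = add_mset x (mset (concat T))"
proof (induction T arbitrary: x)
  case (Cons r T)
  show ?case
    by (cases r x T rule: schensted_insert_Cons_cases) (simp_all add: Cons)
qed simp

lemma mset_schensted: "mset (concat (schensted w)) = mset w"
proof (induction w rule: rev_induct)
  case Nil
  then show ?case by (simp add: schensted_def)
qed (simp add: schensted_snoc mset_schensted_insert)

section \<open>Columns of a tableau and the upper bound in Greene's theorem\<close>

fun tableau_column :: "nat \<Rightarrow> 'a list list \<Rightarrow> 'a list" where
  "tableau_column j [] = []"
| "tableau_column j (r # T) = (if j < length r then r ! j # tableau_column j T else tableau_column j T)"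

lemma set_column: "set (tableau_column j T) = {r ! j | r. r \<in> set T \<and> j < length r}"
  by (induction T) auto

lemma filter_eq_singleton:
  "distinct xs \<Longrightarrow> x \<in> set xs \<Longrightarrow> filter (\<lambda>y. y = x) xs = [x]"
  by (induction xs) (auto simp: filter_empty_conv)

text \<open>With distinct entries, membership in a column identifies its cells. Since rows are read
  from the bottom up, the column appears reversed, hence decreasing in a tableau.\<close>

lemma filter_column_reading_word:
  assumes "distinct (concat T)"
  shows "filter (\<lambda>x. x \<in> set (tableau_column j T)) (reading_word T) = rev (tableau_column j T)"
  using assms
proof (induction T)
  case (Cons r T)
  have disj: "set r \<inter> set (concat T) = {}" using Cons.prems by auto
  have sub: "set (tableau_column j T) \<subseteq> set (concat T)" by (auto simp: set_column)
  have left: "filter (\<lambda>x. x \<in> set (tableau_column j (r # T))) (reading_word T)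
    = filter (\<lambda>x. x \<in> set (tableau_column j T)) (reading_word T)"
    using disj by (intro filter_cong refl) (use nth_mem in \<open>fastforce split: if_splits\<close>)
  have right: "filter (\<lambda>x. x \<in> set (tableau_column j (r # T))) r = (if j < length r then [r ! j] else [])"
  proof (cases "j < length r")
    case True
    have "filter (\<lambda>x. x \<in> set (tableau_column j (r # T))) r = filter (\<lambda>x. x = r ! j) r"
      using disj sub True by (intro filter_cong) auto
    also have "\<dots> = [r ! j]"
      using Cons.prems True by (intro filter_eq_singleton) auto
    finally show ?thesis
      using True by simp
  next
    case False
    then show ?thesis
      using disj sub by (auto simp: filter_empty_conv)
  qed
  show ?case
    using Cons left right by (simp del: tableau_column.simps) simp
qed simp

lemma sorted_wrt_column:
  assumes "tableau T"
  shows "sorted_wrt (<) (tableau_column j T)"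
proof -
  have "sorted_wrt dominates T"
    using assms by (simp add: tableau_def successively_conv_sorted_wrt[OF transp_dominates])
  then show ?thesis
    by (induction T) (auto simp: set_column dominates_def)
qed

text \<open>Row lengths decrease weakly, so a column occupies an initial segment of the rows and
  truncation to \<open>m\<close> rows cuts it to height \<open>m\<close>.\<close>

lemma length_column_le:
  fixes T :: "'a::linorder list list"
  assumes "tableau T"
  shows "min m (length (tableau_column j T)) \<le> length (tableau_column j (take m T))"
proof -
  have "sorted_wrt dominates T"
    using assms by (simp add: tableau_def successively_conv_sorted_wrt[OF transp_dominates])
  then show ?thesis
  proof (induction T arbitrary: m)
    case (Cons r T)
    show ?case
    proof (cases m)
      case (Suc m')
      show ?thesis
      proof (cases "j < length r")
        case True
        then show ?thesis using Cons Suc by fastforce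
      next
        case False
        then have "tableau_column j T = []"
          using Cons.prems by (auto simp: dominates_def set_column simp flip: set_empty)
        then show ?thesis using False by simp
      qed
    qed simp
  qed simp
qed

text \<open>Double counting of the cells; columns beyond the end of all rows are empty, so any bound
  \<open>N\<close> on the row lengths will do.\<close>

lemma sum_length_column:
  assumes "\<forall>r\<in>set T. length r \<le> N"
  shows "(\<Sum>j<N. length (tableau_column j T)) = length (concat T)"
  using assms
proof (induction T)
  case (Cons r T)
  have "(\<Sum>j<N. length (tableau_column j (r # T))) = (\<Sum>j<N. (if j < length r then 1 else 0) + length (tableau_column j T))"
    by (intro sum.cong) auto
  also have "\<dots> = card {j \<in> {..<N}. j < length r} + length (concat T)"
    using Cons by (simp add: sum.distrib sum.If_cases Int_def)
  also have "{j \<in> {..<N}. j < length r} = {..<length r}"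
    using Cons.prems by auto
  finally show ?case by simp
qed simp

lemma mset_reading_word: "mset (reading_word T) = mset (concat T)"
  by (induction T) auto

text \<open>The letters of \<open>v\<close> in one column form a decreasing subsequence, so there
  are at most \<open>m\<close> of them and no more than the column has cells. Summed over the
  columns, these bounds count the cells of the first \<open>m\<close> rows.\<close>

lemma avoiding_length_reading_word_le:
  fixes T :: "'a::linorder list list"
  assumes T: "tableau T" "distinct (concat T)"
    and v: "subseq v (reading_word T)" "avoids_decreasing (Suc m) v"
  shows "length v \<le> length (concat (take m T))"
proof -
  define N where "N = Max (insert 0 (length ` set T))"
  have N: "length r \<le> N" if "r \<in> set T" for r
    unfolding N_def using that by (intro Max_ge) auto
  have dist: "distinct v"
    using v(1) T(2) mset_reading_word[of T]
    by (intro subseqs_distinctD[of v "reading_word T"]) (auto dest: mset_eq_imp_distinct_iff)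
  have "set v \<subseteq> (\<Union>j<N. set (tableau_column j T))"
  proof
    fix x
    assume "x \<in> set v"
    then have "x \<in> set (concat T)"
      using set_subseq_subset[OF v(1)] by auto
    then obtain r j where "r \<in> set T" "j < length r" "x = r ! j"
      by (auto simp: in_set_conv_nth)
    then show "x \<in> (\<Union>j<N. set (tableau_column j T))"
      using N[of r] by (fastforce simp: set_column)
  qed
  then have "set v = (\<Union>j<N. set v \<inter> set (tableau_column j T))" by auto
  then have "length v \<le> (\<Sum>j<N. card (set v \<inter> set (tableau_column j T)))"
    using card_UN_le[of "{..<N}" "\<lambda>j. set v \<inter> set (tableau_column j T)"] distinct_card[OF dist] by simp
  also have "\<dots> \<le> (\<Sum>j<N. length (tableau_column j (take m T)))"
  proof (rule sum_mono)
    fix j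
    let ?f = "filter (\<lambda>x. x \<in> set (tableau_column j T))"
    have "subseq (?f v) (?f (reading_word T))"
      using v(1) by (rule subseq_filter)
    moreover have "sorted_wrt (>) (?f (reading_word T))"
      using sorted_wrt_column[OF T(1)] by (simp add: filter_column_reading_word[OF T(2)] sorted_wrt_rev)
    ultimately have "sorted_wrt (>) (?f v)"
      by (rule sorted_wrt_subseq)
    then have "length (?f v) \<le> m"
      using avoids_decreasingD[OF v(2)] subseq_filter_left by (metis less_Suc_eq_le)
    moreover have "card (set v \<inter> set (tableau_column j T)) = length (?f v)"
      using distinct_card[of "?f v"] dist by (simp add: Int_def)
    moreover have "card (set v \<inter> set (tableau_column j T)) \<le> length (tableau_column j T)"
      by (meson Int_lower2 List.finite_set card_length card_mono order_trans)
    ultimately show "card (set v \<inter> set (tableau_column j T)) \<le> length (tableau_column j (take m T))"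
      using length_column_le[OF T(1), of m j] by simp
  qed
  also have "\<dots> = length (concat (take m T))"
    using N by (intro sum_length_column) (auto dest: in_set_takeD)
  finally show ?thesis .
qed

text \<open>A strictly decreasing sequence takes at most one letter from each weakly increasing
  row.\<close>

lemma length_decreasing_in_rows:
  assumes "\<forall>r\<in>set T. sorted r" "subseq ds (reading_word T)" "sorted_wrt (>) ds"
  shows "length ds \<le> length T"
  using assms
proof (induction T arbitrary: ds)
  case (Cons r T)
  then obtain d1 d2 where d: "ds = d1 @ d2" "subseq d1 (reading_word T)" "subseq d2 r"
    by (auto elim: subseq_appendE)
  have "sorted d2"
    using sorted_wrt_subseq[OF d(3)] Cons.prems(1) by simp
  moreover have "sorted_wrt (>) d2"
    using d Cons.prems by (simp add: sorted_wrt_append)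
  ultimately have "length d2 \<le> 1"
    by (cases d2 rule: remdups_adj.cases) auto
  moreover have "length d1 \<le> length T"
    using d Cons by (simp add: sorted_wrt_append)
  ultimately show ?case using d by simp
qed simp

lemma Max_avoiding_lengths_schensted:
  fixes w :: "'a::linorder list"
  assumes "distinct w"
  shows "Max (avoiding_lengths (Suc m) w) = length (concat (take m (schensted w)))"
proof -
  let ?T = "schensted w"
  have "distinct (concat ?T)"
    using assms mset_schensted[of w] by (metis mset_eq_imp_distinct_iff)
  have eq: "avoiding_lengths (Suc m) w = avoiding_lengths (Suc m) (reading_word ?T)"
    using avoiding_lengths_schensted[of "Suc m" w "[]"] by simp
  let ?v = "reading_word (take m ?T)"
  \<comment> \<open>The first rows are read last, so they form a suffix of the reading word.\<close>
  have "reading_word ?T = reading_word (drop m ?T) @ ?v"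
    by (metis append_take_drop_id concat_append rev_append)
  then have "subseq ?v (reading_word ?T)" by (simp add: subseq_drop_many)
  moreover have "avoids_decreasing (Suc m) ?v"
    unfolding avoids_decreasing_def
  proof (intro allI impI)
    fix ds
    assume "subseq ds ?v" "sorted_wrt (>) ds"
    then have "length ds \<le> length (take m ?T)"
      using tableau_schensted[of w]
      by (intro length_decreasing_in_rows) (auto simp: tableau_def dest: in_set_takeD)
    then show "length ds < Suc m" by simp
  qed
  moreover have "length ?v = length (concat (take m ?T))"
    using mset_reading_word by (metis size_mset)
  ultimately have "length (concat (take m ?T)) \<in> avoiding_lengths (Suc m) w"
    unfolding eq by (auto simp: avoiding_lengths_def intro!: exI[of _ ?v])
  moreover have "l \<le> length (concat (take m ?T))" if "l \<in> avoiding_lengths (Suc m) w" for l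
    using that avoiding_length_reading_word_le[OF tableau_schensted \<open>distinct (concat ?T)\<close>]
    unfolding eq by (auto simp: avoiding_lengths_def)
  ultimately show ?thesis
    by (intro Max_eqI) (auto intro: finite_subset[of _ "{..length (concat (take m ?T))}"])
qed

section \<open>The particle process\<close>

text \<open>A missing row counts as empty, like a line that no particle has reached.\<close>

definition tableau_row :: "'a list list \<Rightarrow> nat \<Rightarrow> 'a list" where
  "tableau_row T i = (if i < length T then T ! i else [])"

lemma tableau_row_simps [simp]: "tableau_row [] i = []" "tableau_row (r # T) 0 = r" "tableau_row (r # T) (Suc i) = tableau_row T i"
  by (auto simp: tableau_row_def)

lemma cascade_stop:
  "{y \<in> L j. x < y} = {} \<Longrightarrow> cascade (Suc m) j x L = L(j := insert x (L j))"
  by (simp only: cascade.simps Let_def simp_thms if_True)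

lemma cascade_bump:
  "{y \<in> L j. x < y} \<noteq> {} \<Longrightarrow> cascade (Suc m) j x L =
    cascade m (Suc j) (Min {y \<in> L j. x < y}) (L(j := insert x (L j - {Min {y \<in> L j. x < y}})))"
  by (simp only: cascade.simps Let_def if_False)

lemma cascade_below: "i < j \<Longrightarrow> cascade m j x L i = L i"
  by (induction m j x L rule: cascade.induct) (auto simp: Let_def)

text \<open>Only the first \<open>m\<close> rows are compared: a letter bumped out of the last of
  them leaves the process but lives on in the tableau. As lines are sets and rows are lists,
  distinctness ensures that deleting y from the set deletes it from the row entirely.\<close>

lemma cascade_schensted_insert:
  assumes "\<And>i. i < m \<Longrightarrow> L (j + i) = set (tableau_row T i)"
    and "\<forall>r\<in>set T. sorted r" "distinct (concat T)" "i < m"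
  shows "cascade m j x L (j + i) = set (tableau_row (schensted_insert x T) i)"
  using assms
proof (induction m arbitrary: j x L T i)
  case (Suc m)
  have Lj: "L j = set (tableau_row T 0)" using Suc.prems(1)[of 0] by simp
  have LSuc: "L (Suc j + i) = set (tableau_row T (Suc i))" if "i < m" for i
    using Suc.prems(1)[of "Suc i"] that by simp
  show ?case
  proof (cases T)
    case Nil
    then show ?thesis
      using Lj LSuc[of "i - 1"] Suc.prems(4) by (cases i) auto
  next
    case (Cons r rs)
    show ?thesis
    proof (cases r x rs rule: schensted_insert_Cons_cases)
      case append
      then have "{y \<in> L j. x < y} = {}" using Lj Cons by auto
      then have "cascade (Suc m) j x L = L(j := insert x (L j))" by (rule cascade_stop)
      then show ?thesis
        using append Lj LSuc[of "i - 1"] Suc.prems(4) Cons by (cases i) auto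
    next
      case (bump r1 y r2)
      have sorted: "sorted (r1 @ y # r2)" and dist: "distinct (r1 @ y # r2)"
        using Suc.prems Cons bump by auto
      have "y \<in> L j" using Lj Cons bump by simp
      moreover have "y \<le> a" if "a \<in> L j" "x < a" for a
        using that Lj Cons bump sorted by (auto simp: sorted_append)
      ultimately have Min: "Min {y \<in> L j. x < y} = y" and ne: "{y \<in> L j. x < y} \<noteq> {}"
        using bump Lj by (auto intro!: Min_eqI)
      let ?L = "L(j := insert x (L j - {y}))"
      have eq: "cascade (Suc m) j x L = cascade m (Suc j) y ?L"
        using cascade_bump[of L j x, OF ne] Min by simp
      show ?thesis
      proof (cases i)
        case 0
        then show ?thesis
          using eq cascade_below[of j "Suc j" m y ?L] Lj Cons bump dist by auto
      next
        case (Suc i')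
        have "cascade m (Suc j) y ?L (Suc j + i') = set (tableau_row (schensted_insert y rs) i')"
          using Suc.prems Suc LSuc Cons by (intro Suc.IH) auto
        then show ?thesis
          using eq bump Suc Cons by simp
      qed
    qed
  qed
qed simp

lemma particle_state_schensted:
  assumes "distinct (map u [0..<n])" "i < k - 1"
  shows "particle_state k n u (Suc i) = set (tableau_row (schensted (map u [0..<n])) i)"
  using assms
proof (induction n arbitrary: i)
  case 0
  then show ?case by (simp add: particle_state_def schensted_def)
next
  case (Suc n)
  let ?T = "schensted (map u [0..<n])"
  have "distinct (concat ?T)"
    using Suc.prems mset_schensted[of "map u [0..<n]"]
    by (simp add: mset_eq_imp_distinct_iff[of "concat ?T" "map u [0..<n]"])
  moreover have "\<forall>r\<in>set ?T. sorted r"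
    using tableau_schensted[of "map u [0..<n]"] by (simp add: tableau_def)
  ultimately have "cascade (k - 1) 1 (u n) (particle_state k n u) (1 + i) = set (tableau_row (schensted_insert (u n) ?T) i)"
    using Suc by (intro cascade_schensted_insert) auto
  then show ?case
    by (simp add: particle_state_def particle_step_def schensted_snoc)
qed

lemma sum_length_row: "(\<Sum>i<m. length (tableau_row T i)) = length (concat (take m T))"
proof (induction T arbitrary: m)
  case (Cons r T)
  then show ?case by (cases m) (simp_all add: sum.lessThan_Suc_shift del: sum.lessThan_Suc)
qed simp

lemma distinct_row: "distinct (concat T) \<Longrightarrow> distinct (tableau_row T i)"
  by (auto simp: tableau_row_def distinct_concat_iff)

lemma particle_count_schensted:
  assumes "distinct (map u [0..<n])"
  shows "particle_count k n u = length (concat (take (k - 1) (schensted (map u [0..<n]))))"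
proof -
  let ?T = "schensted (map u [0..<n])"
  have dist: "distinct (concat ?T)"
    using assms mset_schensted by (metis mset_eq_imp_distinct_iff)
  have "particle_count k n u = (\<Sum>i<k-1. card (particle_state k n u (Suc i)))"
    unfolding particle_count_def
    by (intro sum.reindex_bij_witness[of _ Suc "\<lambda>j. j - 1"]) auto
  also have "\<dots> = (\<Sum>i<k-1. length (tableau_row ?T i))"
    using assms dist
    by (intro sum.cong refl) (simp add: particle_state_schensted distinct_card distinct_row)
  finally show ?thesis by (simp add: sum_length_row)
qed

section \<open>From patterns at index sets to subsequences of words\<close>

lemma contains_decreasing_iff:
  assumes "finite J"
  shows "contains_pattern a J (decreasing_perm k) k
    \<longleftrightarrow> \<not> avoids_decreasing k (map a (sorted_list_of_set J))"
proof
  assume "contains_pattern a J (decreasing_perm k) k"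
  then obtain i where i: "\<And>s. s \<in> {1..k} \<Longrightarrow> i s \<in> J"
    "\<And>s t. 1 \<le> s \<Longrightarrow> s < t \<Longrightarrow> t \<le> k \<Longrightarrow> i s < i t"
    "\<And>s t. s \<in> {1..k} \<Longrightarrow> t \<in> {1..k} \<Longrightarrow> a (i s) < a (i t) \<longleftrightarrow> k + 1 - s < k + 1 - t"
    unfolding contains_pattern_def decreasing_perm_def by blast
  let ?is = "map i [1..<Suc k]"
  have inc: "sorted_wrt (<) ?is"
    using i(2) by (auto simp: sorted_wrt_map simp del: upt_Suc intro!: sorted_wrt_mono_rel[OF _ sorted_wrt_upt])
  have "subseq ?is (sorted_list_of_set J)"
    using inc i(1) assms
    by (intro sorted_subset_imp_subseq) (auto simp del: upt_Suc)
  then have "subseq (map a ?is) (map a (sorted_list_of_set J))"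
    by (rule subseq_map)
  moreover have "sorted_wrt (>) (map a ?is)"
    using i(3) by (auto simp: sorted_wrt_map simp del: upt_Suc intro!: sorted_wrt_mono_rel[OF _ sorted_wrt_upt])
  ultimately show "\<not> avoids_decreasing k (map a (sorted_list_of_set J))"
    using avoids_decreasingD[of k "map a (sorted_list_of_set J)" "map a ?is"]
    by (auto simp del: upt_Suc)
next
  assume "\<not> avoids_decreasing k (map a (sorted_list_of_set J))"
  then obtain ds where ds: "subseq ds (map a (sorted_list_of_set J))" "sorted_wrt (>) ds" "k \<le> length ds"
    by (auto simp: avoids_decreasing_def not_less)
  then obtain N where "ds = nths (map a (sorted_list_of_set J)) N"
    by (auto simp: subseq_conv_nths)
  then have ds_eq: "ds = map a (nths (sorted_list_of_set J) N)"
    by (simp add: nths_map)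
  let ?is = "nths (sorted_list_of_set J) N"
  have sub: "subseq ?is (sorted_list_of_set J)"
    by (auto simp: subseq_conv_nths)
  have inc: "sorted_wrt (<) ?is"
    using sub by (rule sorted_wrt_subseq) simp
  have len: "k \<le> length ?is" using ds ds_eq by simp
  have mem: "?is ! i \<in> J" if "i < k" for i
    using that len nth_mem[of i ?is] set_subseq_subset[OF sub] assms by auto
  have dec: "a (?is ! t) < a (?is ! s)" if "s < t" "t < k" for s t
    using sorted_wrt_nth_less[OF ds(2), of s t] that len ds_eq by simp
  show "contains_pattern a J (decreasing_perm k) k"
    unfolding contains_pattern_def decreasing_perm_def
  \<comment> \<open>The first k members of a possibly longer decreasing sequence are used; patterns
    are indexed from 1, lists from 0.\<close>
  proof (intro exI[of _ "\<lambda>s. ?is ! (s - 1)"] conjI ballI allI impI)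
    fix s assume "s \<in> {1..k}"
    then show "?is ! (s - 1) \<in> J" by (intro mem) auto
  next
    fix s t assume "1 \<le> s" "s < t" "t \<le> k"
    then show "?is ! (s - 1) < ?is ! (t - 1)"
      using len by (intro sorted_wrt_nth_less[OF inc]) auto
  next
    fix s t assume st: "s \<in> {1..k}" "t \<in> {1..k}"
    show "a (?is ! (s - 1)) < a (?is ! (t - 1)) \<longleftrightarrow> k + 1 - s < k + 1 - t"
    proof (cases s t rule: linorder_cases)
      case less
      then have "a (?is ! (t - 1)) < a (?is ! (s - 1))" using st by (intro dec) auto
      then show ?thesis using less st by auto
    next
      case greater
      then have "a (?is ! (s - 1)) < a (?is ! (t - 1))" using st by (intro dec) auto
      then show ?thesis using greater st by auto
    qed simp
  qed
qed

lemma avoiding_lengths_upt: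
  "{card J | J. J \<subseteq> {1..n} \<and> \<not> contains_pattern a J (decreasing_perm k) k}
    = avoiding_lengths k (map a [1..<Suc n])"
proof (intro set_eqI iffI)
  fix l
  assume "l \<in> {card J | J. J \<subseteq> {1..n} \<and> \<not> contains_pattern a J (decreasing_perm k) k}"
  then obtain J where J: "l = card J" "J \<subseteq> {1..n}" "\<not> contains_pattern a J (decreasing_perm k) k"
    by blast
  then have "finite J" using finite_subset by blast
  with J have "subseq (sorted_list_of_set J) [1..<Suc n]"
    by (intro sorted_subset_imp_subseq) (auto simp del: upt_Suc)
  then have "subseq (map a (sorted_list_of_set J)) (map a [1..<Suc n])"
    by (rule subseq_map)
  then show "l \<in> avoiding_lengths k (map a [1..<Suc n])"
    using J contains_decreasing_iff[OF \<open>finite J\<close>, of a k] unfolding avoiding_lengths_def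
    by (intro CollectI exI[of _ "map a (sorted_list_of_set J)"]) auto
next
  fix l
  assume "l \<in> avoiding_lengths k (map a [1..<Suc n])"
  then obtain v where v: "l = length v" "subseq v (map a [1..<Suc n])" "avoids_decreasing k v"
    by (auto simp: avoiding_lengths_def)
  then obtain N where N: "v = map a (nths [1..<Suc n] N)"
    by (auto simp: subseq_conv_nths nths_map)
  let ?is = "nths [1..<Suc n] N"
  have sub: "subseq ?is [1..<Suc n]" by (auto simp: subseq_conv_nths)
  have "sorted_wrt (<) ?is" using sub by (rule sorted_wrt_subseq) (rule sorted_wrt_upt)
  then have is_eq: "sorted_list_of_set (set ?is) = ?is"
    by (simp add: strict_sorted_iff sorted_list_of_set.idem_if_sorted_distinct)
  have "set ?is \<subseteq> {1..n}" using set_subseq_subset[OF sub] by auto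
  moreover have "\<not> contains_pattern a (set ?is) (decreasing_perm k) k"
    using contains_decreasing_iff[of "set ?is" a k] is_eq v(3) N by simp
  moreover have "l = card (set ?is)"
    using v N is_eq by (metis length_map length_sorted_list_of_set)
  ultimately show "l \<in> {card J | J. J \<subseteq> {1..n} \<and> \<not> contains_pattern a J (decreasing_perm k) k}"
    by blast
qed

text \<open>The deterministic core: the process is run with the values of the permutation as
  positions, so both sides become the size of the first k - 1 rows of one tableau.\<close>

lemma particle_count_eq_longest_avoiding:
  assumes "inj_on \<sigma> {1..n}" "k \<ge> 1"
  shows "particle_count k n (\<lambda>i. real (\<sigma> (Suc i))) = longest_avoiding n (decreasing_perm k) k \<sigma>"
proof -
  let ?a = "\<lambda>i. real (\<sigma> i)"
  have w: "map (\<lambda>i. real (\<sigma> (Suc i))) [0..<n] = map ?a [1..<Suc n]"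
    using map_map[of ?a Suc "[0..<n]"] by (simp add: map_Suc_upt comp_def del: upt_Suc map_map)
  have dist: "distinct (map ?a [1..<Suc n])"
  proof -
    have "inj_on ?a {1..n}"
      using assms(1) by (intro inj_onI) (metis inj_onD of_nat_eq_iff)
    then show ?thesis
      by (simp add: distinct_map atLeastLessThanSuc_atLeastAtMost del: upt_Suc)
  qed
  have pattern: "contains_pattern ?a J \<tau> k = contains_pattern \<sigma> J \<tau> k" for J \<tau>
    by (simp add: contains_pattern_def)
  have "longest_avoiding n (decreasing_perm k) k \<sigma> = Max (avoiding_lengths k (map ?a [1..<Suc n]))"
    unfolding longest_avoiding_def avoiding_lengths_upt[symmetric] pattern ..
  also have "\<dots> = length (concat (take (k - 1) (schensted (map ?a [1..<Suc n]))))"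
    using Max_avoiding_lengths_schensted[OF dist, of "k - 1"] assms(2) by simp
  also have "\<dots> = particle_count k n (\<lambda>i. real (\<sigma> (Suc i)))"
    using particle_count_schensted[of "\<lambda>i. real (\<sigma> (Suc i))" n k] dist by (simp only: w)
  finally show ?thesis by simp
qed

section \<open>Dependence of the process on relative order alone\<close>

lemma cascade_subset:
  assumes "x \<in> S" "\<And>i. L i \<subseteq> S" "\<And>i. finite (L i)"
  shows "cascade m j x L i \<subseteq> S \<and> finite (cascade m j x L i)"
  using assms
proof (induction m arbitrary: j x L)
  case (Suc m)
  show ?case
  proof (cases "{y \<in> L j. x < y} = {}")
    case True
    then show ?thesis using Suc.prems unfolding cascade_stop[of L j x, OF True] by auto
  next
    case False
    then have "Min {y \<in> L j. x < y} \<in> S"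
      using Min_in[of "{y \<in> L j. x < y}"] Suc.prems by auto
    moreover have "(L(j := insert x (L j - {Min {y \<in> L j. x < y}}))) i \<subseteq> S"
      "finite ((L(j := insert x (L j - {Min {y \<in> L j. x < y}}))) i)" for i
      using Suc.prems by auto
    ultimately show ?thesis
      unfolding cascade_bump[of L j x, OF False] by (rule Suc.IH)
  qed
qed simp

text \<open>The process uses comparison, minimum and removal of a point. The first two commute with
  a strictly increasing map, the third because the map is injective on \<open>S\<close>.\<close>

lemma cascade_image:
  assumes h: "strict_mono_on S h"
    and "x \<in> S" "\<And>i. L i \<subseteq> S" "\<And>i. finite (L i)"
  shows "cascade m j (h x) (\<lambda>i. h ` L i) = (\<lambda>i. h ` cascade m j x L i)"
  using assms(2-)
proof (induction m arbitrary: j x L)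
  case (Suc m)
  let ?R = "{y \<in> L j. x < y}"
  have less_iff: "h a < h b \<longleftrightarrow> a < b" if "a \<in> S" "b \<in> S" for a b
    using h that by (rule strict_mono_on_less)
  have R: "{y \<in> h ` L j. h x < y} = h ` ?R"
    using less_iff Suc.prems by blast
  show ?case
  proof (cases "?R = {}")
    case True
    then have "{y \<in> h ` L j. h x < y} = {}" using R by simp
    then show ?thesis
      unfolding cascade_stop[of L j x, OF True]
      by (subst cascade_stop[of "\<lambda>i. h ` L i" j "h x"]) (auto simp: fun_eq_iff)
  next
    case False
    have mem: "Min ?R \<in> ?R" using False Suc.prems by (intro Min_in) auto
    then have S: "Min ?R \<in> S" using Suc.prems by auto
    have Min: "Min (h ` ?R) = h (Min ?R)"
    proof (rule Min_eqI)
      fix b assume "b \<in> h ` ?R"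
      then obtain c where c: "c \<in> ?R" "b = h c" by blast
      then have "Min ?R \<le> c" using Suc.prems by (intro Min_le) auto
      moreover have "c \<in> S" using c Suc.prems by auto
      ultimately show "h (Min ?R) \<le> b"
        using c(2) strict_mono_on_leD[OF h S] by simp
    qed (use mem Suc.prems in auto)
    let ?L = "L(j := insert x (L j - {Min ?R}))"
    have "inj_on h S" using h by (rule strict_mono_on_imp_inj_on)
    then have "h ` (L j - {Min ?R}) = h ` L j - {h (Min ?R)}"
      using S Suc.prems inj_on_image_set_diff[of h S "L j" "{Min ?R}"] by auto
    then have L: "(\<lambda>i. h ` L i)(j := insert (h x) (h ` L j - {h (Min ?R)})) = (\<lambda>i. h ` ?L i)"
      by (auto simp: fun_eq_iff)
    have "cascade m (Suc j) (h (Min ?R)) (\<lambda>i. h ` ?L i) = (\<lambda>i. h ` cascade m (Suc j) (Min ?R) ?L i)"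
      using S Suc.prems by (intro Suc.IH) auto
    moreover have "{y \<in> h ` L j. h x < y} \<noteq> {}" using R False by simp
    ultimately show ?thesis
      unfolding cascade_bump[of L j x, OF False]
      by (subst cascade_bump[of "\<lambda>i. h ` L i" j "h x"]) (simp_all only: R Min L, simp)
  qed
qed simp

lemma particle_state_subset:
  assumes "\<And>i. i < n \<Longrightarrow> u i \<in> S"
  shows "particle_state k n u j \<subseteq> S \<and> finite (particle_state k n u j)"
  using assms
proof (induction n arbitrary: j)
  case (Suc n)
  then show ?case
    using cascade_subset[of "u n" S "particle_state k n u" "k - 1" 1 j]
    by (simp add: particle_state_def particle_step_def)
qed (simp add: particle_state_def)

lemma particle_state_image:
  assumes "strict_mono_on S h" "\<And>i. i < n \<Longrightarrow> u i \<in> S" "\<And>i. i < n \<Longrightarrow> v i = h (u i)"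
  shows "particle_state k n v = (\<lambda>j. h ` particle_state k n u j)"
  using assms(2-)
proof (induction n)
  case (Suc n)
  have "particle_state k (Suc n) v = cascade (k - 1) 1 (h (u n)) (\<lambda>j. h ` particle_state k n u j)"
    using Suc by (simp add: particle_state_def particle_step_def)
  also have "\<dots> = (\<lambda>j. h ` cascade (k - 1) 1 (u n) (particle_state k n u) j)"
    using Suc.prems particle_state_subset[of n u S k] by (intro cascade_image[OF assms(1)]) auto
  finally show ?case by (simp add: particle_state_def particle_step_def)
qed (simp add: particle_state_def)

lemma particle_count_image:
  assumes "strict_mono_on S h" "\<And>i. i < n \<Longrightarrow> u i \<in> S" "\<And>i. i < n \<Longrightarrow> v i = h (u i)"
  shows "particle_count k n v = particle_count k n u"
proof -
  have "card (h ` particle_state k n u j) = card (particle_state k n u j)" for j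
    using strict_mono_on_imp_inj_on[OF assms(1)] particle_state_subset[of n u S k j] assms(2)
    by (intro card_image) (auto intro: inj_on_subset)
  then show ?thesis
    using particle_state_image[of S h n u v k] assms by (simp add: particle_count_def)
qed

definition relative_rank :: "nat \<Rightarrow> (nat \<Rightarrow> 'a::linorder) \<Rightarrow> 'a \<Rightarrow> nat" where
  "relative_rank n u x = card {j \<in> {..<n}. u j < x}"

lemma relative_rank_strict_mono: "strict_mono_on (u ` {..<n}) (relative_rank n u)"
proof (rule strict_mono_onI)
  fix x y assume "x \<in> u ` {..<n}" "y \<in> u ` {..<n}" "x < y"
  then show "relative_rank n u x < relative_rank n u y"
    unfolding relative_rank_def by (intro psubset_card_mono) (auto intro: less_trans)
qed

text \<open>Ranks start at 0; the shift \<open>c\<close> allows both the ranks themselves and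
  permutation values, which start at 1. Ties among the points are covered as well.\<close>

lemma particle_count_relative_rank:
  assumes "\<And>i. i < n \<Longrightarrow> v i = real (relative_rank n u (u i)) + c"
  shows "particle_count k n v = particle_count k n u"
proof (rule particle_count_image)
  show "strict_mono_on (u ` {..<n}) (\<lambda>x. real (relative_rank n u x) + c)"
    using relative_rank_strict_mono[of u n] by (simp add: strict_mono_on_def)
qed (use assms in auto)

section \<open>Relative order of independent points\<close>

text \<open>By Fubini: once the other coordinates are fixed, coordinate \<open>i\<close> would have
  to hit the single value \<open>u j\<close>, a null set.\<close>

lemma AE_PiM_coordinates_distinct:
  fixes M :: "'a::{second_countable_topology, t2_space} measure"
  assumes M: "prob_space M" "sets M = sets borel" "\<And>x. emeasure M {x} = 0"
    and I: "finite I" "i \<in> I" "j \<in> I" "i \<noteq> j"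
  shows "AE u in Pi\<^sub>M I (\<lambda>_. M). u i \<noteq> u j"
proof -
  interpret product_prob_space "\<lambda>_. M" I
    using M(1) by (intro product_prob_spaceI)
  let ?P = "Pi\<^sub>M I (\<lambda>_. M)"
  have coord: "(\<lambda>u. u l) \<in> borel_measurable ?P" if "l \<in> I" for l
    using measurable_component_singleton[OF that, of "\<lambda>_. M"] M(2) by (simp cong: measurable_cong_sets)
  have set: "{u \<in> space ?P. u i = u j} \<in> sets ?P"
    using coord[OF I(2)] coord[OF I(3)] by measurable
  have I_eq: "insert i (I - {i}) = I" using I by auto
  have "emeasure ?P {u \<in> space ?P. u i = u j} = (\<integral>\<^sup>+u. indicator {u \<in> space ?P. u i = u j} u \<partial>?P)"
    using set by simp
  also have "\<dots> = (\<integral>\<^sup>+u. (\<integral>\<^sup>+y. indicator {u \<in> space ?P. u i = u j} (u(i := y)) \<partial>M) \<partial>Pi\<^sub>M (I - {i}) (\<lambda>_. M))"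
    using product_nn_integral_insert[of "I - {i}" i "indicator {u \<in> space ?P. u i = u j}", unfolded I_eq]
      set I by simp
  also have "\<dots> = (\<integral>\<^sup>+u. 0 \<partial>Pi\<^sub>M (I - {i}) (\<lambda>_. M))"
  proof (rule nn_integral_cong)
    fix u
    have "(\<integral>\<^sup>+y. indicator {u \<in> space ?P. u i = u j} (u(i := y)) \<partial>M) \<le> (\<integral>\<^sup>+y. indicator {u j} y \<partial>M)"
      using I by (intro nn_integral_mono) (auto split: split_indicator)
    also have "\<dots> = 0"
      using M by simp
    finally show "(\<integral>\<^sup>+y. indicator {u \<in> space ?P. u i = u j} (u(i := y)) \<partial>M) = 0" by simp
  qed
  finally have "emeasure ?P {u \<in> space ?P. u i = u j} = 0" by simp
  then show ?thesis
    using set by (auto simp: AE_iff_measurable[OF set])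
qed

text \<open>Beyond independence and a common law, absence of atoms is the only property of the
  uniform distribution that enters.\<close>

locale iid_continuous =
  fixes M :: "real measure" and n :: nat
  assumes prob_space: "prob_space M" and sets_eq: "sets M = sets borel"
    and no_atoms: "emeasure M {x} = 0"
begin

abbreviation P :: "(nat \<Rightarrow> real) measure" where
  "P \<equiv> Pi\<^sub>M {..<n} (\<lambda>_. M)"

sublocale P: prob_space P
  using prob_space by (intro prob_space_PiM)

lemma AE_inj_on: "AE u in P. inj_on u {..<n}"
proof -
  have "AE u in P. \<forall>i\<in>{..<n}. \<forall>j\<in>{..<n}. i \<noteq> j \<longrightarrow> u i \<noteq> u j"
    using AE_PiM_coordinates_distinct[OF prob_space sets_eq no_atoms, of "{..<n}"]
    by (intro AE_finite_allI) auto
  then show ?thesis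
    by eventually_elim (auto simp: inj_on_def)
qed

lemma measurable_coordinate: "i < n \<Longrightarrow> (\<lambda>u. u i) \<in> borel_measurable P"
  using measurable_component_singleton[of i "{..<n}" "\<lambda>_. M"] sets_eq by (simp cong: measurable_cong_sets)

lemma measurable_relative_rank:
  assumes "i < n"
  shows "(\<lambda>u. relative_rank n u (u i)) \<in> measurable P (count_space UNIV)"
proof -
  have eq: "relative_rank n u (u i) = (\<Sum>j<n. if u j < u i then 1 else 0)" for u :: "nat \<Rightarrow> real"
    by (simp add: relative_rank_def sum.If_cases Int_def)
  have "{u \<in> space P. u j < u i} \<in> sets P" if "j < n" for j
    using measurable_coordinate[OF that] measurable_coordinate[OF assms] by measurable
  then show ?thesis
    unfolding eq by measurable
qed

definition rank_event :: "(nat \<Rightarrow> nat) \<Rightarrow> (nat \<Rightarrow> real) set" where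
  "rank_event f = {u \<in> space P. \<forall>i<n. relative_rank n u (u i) = f i}"

lemma rank_event_sets: "rank_event f \<in> sets P"
proof -
  have "{u \<in> space P. \<forall>i\<in>{..<n}. relative_rank n u (u i) = f i} \<in> sets P"
  proof (rule sets.sets_Collect_finite_All)
    show "{u \<in> space P. relative_rank n u (u i) = f i} \<in> sets P" if "i \<in> {..<n}" for i
      using measurable_sets[OF measurable_relative_rank[of i], of "{f i}"] that
      by (simp add: vimage_def Int_def conj_commute)
  qed auto
  then show ?thesis by (simp only: rank_event_def Ball_def lessThan_iff)
qed

lemma particle_count_rank_event:
  assumes "u \<in> rank_event f"
  shows "particle_count k n u = particle_count k n (\<lambda>i. real (f i) + c)"
  using assms by (intro particle_count_relative_rank[symmetric]) (simp add: rank_event_def)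

text \<open>The count is constant on each rank event, and finitely many such events cover the space.
  Points with ties have ranks too, so the argument is not restricted to almost all points.\<close>

lemma measurable_particle_count: "particle_count k n \<in> measurable P (count_space UNIV)"
proof (rule measurable_count_space_eq2_countable[THEN iffD2], safe)
  fix c
  let ?F = "{f \<in> {..<n} \<rightarrow>\<^sub>E {..n}. particle_count k n (\<lambda>i. real (f i)) = c}"
  have "particle_count k n -` {c} \<inter> space P = (\<Union>f\<in>?F. rank_event f)"
  proof (intro equalityI subsetI)
    fix u
    assume u: "u \<in> particle_count k n -` {c} \<inter> space P"
    let ?f = "\<lambda>i\<in>{..<n}. relative_rank n u (u i)"
    have "relative_rank n u x \<le> n" for x
      unfolding relative_rank_def by (rule order.trans[OF card_mono[of "{..<n}"]]) auto
    then have "?f \<in> {..<n} \<rightarrow>\<^sub>E {..n}" by auto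
    moreover have "u \<in> rank_event ?f" using u by (auto simp: rank_event_def)
    ultimately show "u \<in> (\<Union>f\<in>?F. rank_event f)"
      using u particle_count_rank_event[of u ?f k 0] by (intro UN_I[of ?f]) simp_all
  next
    fix u
    assume "u \<in> (\<Union>f\<in>?F. rank_event f)"
    then obtain f where f: "u \<in> rank_event f" "particle_count k n (\<lambda>i. real (f i)) = c" by auto
    moreover have "u \<in> space P" using f(1) by (simp add: rank_event_def)
    ultimately show "u \<in> particle_count k n -` {c} \<inter> space P"
      using particle_count_rank_event[OF f(1), of k 0] by simp
  qed
  also have "\<dots> \<in> sets P"
    by (intro sets.finite_UN rank_event_sets) (auto intro: finite_subset[OF _ finite_PiE[of "{..<n}" "\<lambda>_. {..n}"]])
  finally show "particle_count k n -` {c} \<inter> space P \<in> sets P" .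
qed auto

abbreviation perm_event :: "(nat \<Rightarrow> nat) \<Rightarrow> (nat \<Rightarrow> real) set" where
  "perm_event \<sigma> \<equiv> rank_event (\<lambda>i. \<sigma> (Suc i) - 1)"

lemma bij_betw_shift:
  assumes "\<sigma> permutes {1..n}"
  shows "bij_betw (\<lambda>i. \<sigma> (Suc i) - 1) {..<n} {..<n}"
proof -
  have "bij_betw Suc {..<n} {1..n}"
    by (rule bij_betw_byWitness[of _ "\<lambda>i. i - 1"]) auto
  moreover have "bij_betw (\<lambda>i. i - 1) {1..n} {..<n}"
    by (rule bij_betw_byWitness[of _ Suc]) auto
  ultimately have "bij_betw ((\<lambda>i. i - 1) \<circ> \<sigma> \<circ> Suc) {..<n} {..<n}"
    using permutes_imp_bij[OF assms] by (blast intro: bij_betw_trans)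
  then show ?thesis by (simp add: comp_def)
qed

text \<open>Exchangeability: permuting the coordinates preserves the product measure and pulls the
  event of any permutation back to that of the identity.\<close>

lemma perm_event_emeasure_eq:
  assumes "\<sigma> permutes {1..n}"
  shows "emeasure P (perm_event \<sigma>) = emeasure P (rank_event (\<lambda>i. i))"
proof -
  define \<pi> where "\<pi> = (\<lambda>i. \<sigma> (Suc i) - 1)"
  have \<pi>: "bij_betw \<pi> {..<n} {..<n}"
    unfolding \<pi>_def using assms by (rule bij_betw_shift)
  define T :: "(nat \<Rightarrow> real) \<Rightarrow> nat \<Rightarrow> real" where "T u = (\<lambda>i\<in>{..<n}. u (\<pi> i))" for u
  have T: "distr P P T = P"
    unfolding T_def using distr_PiM_reindex[of "{..<n}" "\<lambda>_. M" \<pi> "{..<n}"] \<pi> prob_space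
    by (auto simp: bij_betw_def)
  have mapsto: "\<pi> i < n" if "i < n" for i
    using bij_betwE[OF \<pi>] that by blast
  have T_meas: "T \<in> measurable P P"
    unfolding T_def by (intro measurable_restrict measurable_component_singleton) (auto intro: mapsto)
  \<comment> \<open>A rank depends only on the family of values, not on how it is indexed.\<close>
  have rank_T: "relative_rank n (T u) x = relative_rank n u x" for u x
  proof -
    have "bij_betw \<pi> {j \<in> {..<n}. T u j < x} {j \<in> {..<n}. u j < x}"
    proof (rule bij_betw_imageI)
      show "inj_on \<pi> {j \<in> {..<n}. T u j < x}"
        using \<pi> by (auto simp: bij_betw_def intro: inj_on_subset)
      have "\<pi> ` {j \<in> {..<n}. T u j < x} = {j \<in> \<pi> ` {..<n}. u j < x}"
        by (auto simp: T_def)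
      then show "\<pi> ` {j \<in> {..<n}. T u j < x} = {j \<in> {..<n}. u j < x}"
        using bij_betw_imp_surj_on[OF \<pi>] by simp
    qed
    then show ?thesis
      unfolding relative_rank_def by (rule bij_betw_same_card)
  qed
  have "T -` perm_event \<sigma> \<inter> space P = rank_event (\<lambda>i. i)"
  proof (intro set_eqI)
    fix u :: "nat \<Rightarrow> real"
    have "(\<forall>i<n. relative_rank n u (u (\<pi> i)) = \<pi> i) \<longleftrightarrow> (\<forall>j\<in>\<pi> ` {..<n}. relative_rank n u (u j) = j)"
      by auto
    also have "\<pi> ` {..<n} = {..<n}"
      using \<pi> by (rule bij_betw_imp_surj_on)
    finally have "(\<forall>i<n. relative_rank n (T u) (T u i) = \<pi> i) \<longleftrightarrow> (\<forall>j<n. relative_rank n u (u j) = j)"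
      unfolding rank_T by (simp add: T_def Ball_def)
    then show "u \<in> T -` perm_event \<sigma> \<inter> space P \<longleftrightarrow> u \<in> rank_event (\<lambda>i. i)"
      using measurable_space[OF T_meas] by (auto simp: rank_event_def \<pi>_def)
  qed
  moreover have "emeasure (distr P P T) (perm_event \<sigma>) = emeasure P (T -` perm_event \<sigma> \<inter> space P)"
    using T_meas rank_event_sets by (rule emeasure_distr)
  ultimately show ?thesis
    unfolding T by simp
qed

lemma AE_perm_event: "AE u in P. \<exists>\<sigma>. \<sigma> permutes {1..n} \<and> u \<in> perm_event \<sigma>"
  using AE_inj_on AE_space
proof eventually_elim
  case (elim u)
  \<comment> \<open>Off the null set of ties the ranks are a bijection onto 0, ..., n - 1;
    \<open>Suc\<close> shifts them to start at 1, and \<open>permutes\<close> asks for fixed points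
    elsewhere.\<close>
  define \<sigma> where "\<sigma> = (\<lambda>i. if i \<in> {1..n} then Suc (relative_rank n u (u (i - 1))) else i)"
  have "inj_on \<sigma> {1..n}"
  proof (rule inj_onI)
    fix i j
    assume ij: "i \<in> {1..n}" "j \<in> {1..n}" "\<sigma> i = \<sigma> j"
    then have "relative_rank n u (u (i - 1)) = relative_rank n u (u (j - 1))"
      by (simp add: \<sigma>_def)
    then have "u (i - 1) = u (j - 1)"
      using strict_mono_on_eqD[OF relative_rank_strict_mono, of n u "u (i - 1)" "u (j - 1)"] ij by auto
    then have "i - 1 = j - 1"
      using elim(1) ij by (auto dest!: inj_onD)
    then show "i = j" using ij by auto
  qed
  moreover have "\<sigma> ` {1..n} \<subseteq> {1..n}"
  proof -
    have "relative_rank n u (u i) < n" if "i < n" for i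
    proof -
      have "relative_rank n u (u i) < card {..<n}"
        unfolding relative_rank_def using that by (intro psubset_card_mono) auto
      then show ?thesis by simp
    qed
    then show ?thesis by (force simp: \<sigma>_def Suc_le_eq)
  qed
  ultimately have "bij_betw \<sigma> {1..n} {1..n}"
    by (simp add: bij_betw_def endo_inj_surj)
  then have "\<sigma> permutes {1..n}"
    by (rule bij_imp_permutes) (auto simp: \<sigma>_def)
  moreover have "u \<in> perm_event \<sigma>"
    using elim(2) by (auto simp: rank_event_def \<sigma>_def)
  ultimately show ?case by blast
qed

lemma disjoint_perm_events: "disjoint_family_on perm_event {\<sigma>. \<sigma> permutes {1..n}}"
  unfolding disjoint_family_on_def
proof (intro ballI impI)
  fix \<sigma> \<tau>
  assume perms: "\<sigma> \<in> {\<sigma>. \<sigma> permutes {1..n}}" "\<tau> \<in> {\<sigma>. \<sigma> permutes {1..n}}" and "\<sigma> \<noteq> \<tau>"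
  then obtain i where i: "\<sigma> i \<noteq> \<tau> i" by blast
  with perms have "i \<in> {1..n}"
    by (metis mem_Collect_eq permutes_not_in)
  moreover from this perms have "\<sigma> i \<in> {1..n}" "\<tau> i \<in> {1..n}"
    by (simp_all add: permutes_in_image del: atLeastAtMost_iff)
  \<comment> \<open>Truncated subtraction keeps the two values apart because both are at least
    1.\<close>
  ultimately have "i - 1 < n" "\<sigma> (Suc (i - 1)) - 1 \<noteq> \<tau> (Suc (i - 1)) - 1"
    using i by auto
  then show "perm_event \<sigma> \<inter> perm_event \<tau> = {}"
    unfolding rank_event_def by fastforce
qed

lemma emeasure_perm_events:
  assumes "S \<subseteq> {\<sigma>. \<sigma> permutes {1..n}}"
  shows "emeasure P (\<Union>\<sigma>\<in>S. perm_event \<sigma>) = of_nat (card S) * emeasure P (rank_event (\<lambda>i. i))"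
proof -
  have "emeasure P (\<Union>\<sigma>\<in>S. perm_event \<sigma>) = (\<Sum>\<sigma>\<in>S. emeasure P (perm_event \<sigma>))"
    using rank_event_sets assms disjoint_perm_events finite_permutations[of "{1..n}"]
    by (intro sum_emeasure[symmetric]) (auto intro: disjoint_family_on_mono finite_subset)
  also have "\<dots> = (\<Sum>\<sigma>\<in>S. emeasure P (rank_event (\<lambda>i. i)))"
    using assms perm_event_emeasure_eq by (intro sum.cong) auto
  finally show ?thesis by simp
qed

text \<open>The n! permutation events are disjoint, equally likely and almost surely
  exhaustive.\<close>

lemma emeasure_rank_identity: "emeasure P (rank_event (\<lambda>i. i)) = ennreal (1 / fact n)"
proof -
  let ?S = "{\<sigma>. \<sigma> permutes {1..n}}"
  have "emeasure P (\<Union>\<sigma>\<in>?S. perm_event \<sigma>) = 1"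
    using AE_perm_event finite_permutations[of "{1..n}"] rank_event_sets
    by (intro P.emeasure_eq_1_AE) (auto intro!: sets.finite_UN)
  moreover have "card ?S = fact n"
    using card_permutations[of "{1..n}" n] by simp
  ultimately have "of_nat (fact n) * emeasure P (rank_event (\<lambda>i. i)) = 1"
    using emeasure_perm_events[of ?S] by simp
  then have "ennreal (fact n * P.prob (rank_event (\<lambda>i. i))) = ennreal 1"
    using ennreal_mult'[of "real (fact n)" "P.prob (rank_event (\<lambda>i. i))"]
    by (simp only: P.emeasure_eq_measure ennreal_of_nat_eq_real_of_nat) simp
  then have "fact n * P.prob (rank_event (\<lambda>i. i)) = 1"
    by (subst (asm) ennreal_inj) auto
  then show ?thesis
    by (simp add: P.emeasure_eq_measure field_simps)
qed

lemma particle_count_perm_event: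
  assumes "\<sigma> permutes {1..n}" "u \<in> perm_event \<sigma>" "k \<ge> 1"
  shows "particle_count k n u = longest_avoiding n (decreasing_perm k) k \<sigma>"
proof -
  have pos: "\<sigma> (Suc i) \<ge> 1" if "i < n" for i
    using permutes_in_image[OF assms(1), of "Suc i"] that by auto
  have "particle_count k n u = particle_count k n (\<lambda>i. real (\<sigma> (Suc i)))"
  proof (rule particle_count_relative_rank[symmetric])
    fix i assume "i < n"
    then show "real (\<sigma> (Suc i)) = real (relative_rank n u (u i)) + 1"
      using assms(2) pos[of i] by (simp add: rank_event_def)
  qed
  also have "\<dots> = longest_avoiding n (decreasing_perm k) k \<sigma>"
    using assms permutes_inj_on by (intro particle_count_eq_longest_avoiding)
  finally show ?thesis .
qed

text \<open>Up to a null set, the event that the count is \<open>c\<close> is the union of the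
  permutation events with longest avoiding length \<open>c\<close>, so its probability is their
  number divided by n!.\<close>

lemma distr_particle_count:
  assumes "k \<ge> 1"
  shows "distr P (count_space UNIV) (particle_count k n)
    = distr (measure_pmf (pmf_of_set {\<sigma>. \<sigma> permutes {1..n}}))
        (count_space UNIV) (longest_avoiding n (decreasing_perm k) k)"
proof (rule measure_eqI_countable[of _ UNIV])
  fix c
  let ?perms = "{\<sigma>. \<sigma> permutes {1..n}}"
  let ?l = "longest_avoiding n (decreasing_perm k) k"
  let ?S = "{\<sigma> \<in> ?perms. ?l \<sigma> = c}"
  have fin: "finite ?perms" by (rule finite_permutations) simp
  have card: "card ?perms = fact n"
    using card_permutations[of "{1..n}" n] by simp
  have ne: "?perms \<noteq> {}" using permutes_id by blast
  have "emeasure (distr P (count_space UNIV) (particle_count k n)) {c}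
      = emeasure P (particle_count k n -` {c} \<inter> space P)"
    by (rule emeasure_distr[OF measurable_particle_count]) simp
  also have "\<dots> = emeasure P (\<Union>\<sigma>\<in>?S. perm_event \<sigma>)"
  proof (rule emeasure_eq_AE)
    show "AE u in P. u \<in> particle_count k n -` {c} \<inter> space P \<longleftrightarrow> u \<in> (\<Union>\<sigma>\<in>?S. perm_event \<sigma>)"
      using AE_perm_event AE_space
      by eventually_elim (use particle_count_perm_event assms in auto)
    show "particle_count k n -` {c} \<inter> space P \<in> sets P"
      by (rule measurable_sets[OF measurable_particle_count]) simp
    show "(\<Union>\<sigma>\<in>?S. perm_event \<sigma>) \<in> sets P"
      using fin rank_event_sets by (intro sets.finite_UN) auto
  qed
  also have "\<dots> = of_nat (card ?S) * ennreal (1 / fact n)"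
    by (subst emeasure_perm_events) (auto simp: emeasure_rank_identity)
  also have "\<dots> = ennreal (card ?S / fact n)"
    by (simp add: ennreal_of_nat_eq_real_of_nat flip: ennreal_mult)
  also have "\<dots> = emeasure (measure_pmf (pmf_of_set ?perms)) (?l -` {c})"
    using fin ne card by (simp add: emeasure_pmf_of_set vimage_def Int_def)
  also have "\<dots> = emeasure (distr (measure_pmf (pmf_of_set ?perms)) (count_space UNIV) ?l) {c}"
    by (subst emeasure_distr) auto
  finally show "emeasure (distr P (count_space UNIV) (particle_count k n)) {c} = \<dots>" .
qed auto

end

theorem theorem2p1:
  fixes k n :: nat
  assumes "k \<ge> 2" and "n \<ge> 1"
  shows "distr (Pi\<^sub>M {..<n} (\<lambda>_. uniform_measure lborel {0..1::real}))
               (count_space UNIV) (particle_count k n)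
       = distr (measure_pmf (pmf_of_set {\<sigma>. \<sigma> permutes {1..n}}))
               (count_space UNIV) (longest_avoiding n (decreasing_perm k) k)"
proof -
  interpret iid_continuous "uniform_measure lborel {0..1::real}" n
  proof (rule iid_continuous.intro)
    show "emeasure (uniform_measure lborel {0..1::real}) {x} = 0" for x
      using emeasure_lborel_countable[of "{0..1} \<inter> {x}"] by simp
    show "prob_space (uniform_measure lborel {0..1::real})"
      by (rule prob_space_uniform_measure) simp_all
  qed simp
  show ?thesis
    using assms(1) by (intro distr_particle_count) simp
qed

end
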